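(* Let $A,B,H,K$ be any logically independent events. The set $\Pi$ of all the coherent assessments $(x,y,z,\mu)$ on the family $\mathcal{F}=\{A|H,\ B|K,\ (A|H)\wedge_{S}(B|K),\ (B|K)|_{S}(A|H)\}$ is $\Pi=\Pi'\cup\Pi''$, where $$\Pi'=\{(x,y,z,\mu): x\in(0,1],\ y\in[0,1],\ z\in[z',z''],\ \mu=\tfrac{z}{x}\},$$ with $$z'=\max\{x+y-1,0\},\qquad z''=\begin{cases}\frac{x+y-2xy}{1-xy}, & \text{if } (x,y)\neq(1,1),\\ 1, & \text{if } (x,y)=(1,1),\end{cases}$$ and $\Pi''=\{(0,y,0,\mu): y\in[0,1],\ \mu\geq 0\}$.
   Context: Events are two-valued entities identified with their indicators (values $1/0$); $\emptyset$ is the impossible event, $AB=A\wedge B$, $\overline{A}$ is the negation. Four events are logically independent if all $16$ conjunctions obtained by taking each event or its negation are different from $\emptyset$. For $H\neq\emptyset$ the conditional event $E|H$ is true if $EH$ is true, false if $\overline{E}H$ is true, void if $\overline{H}$ is true. Once $P(E|H)=p$ is assessed, $E|H$ is also the random quantity $EH+p\overline{H}$; numerically $\overline{A}|H=1-A|H$. Sobocinski (quasi) conjunction (a conditional event): $(A|H)\wedge_S(B|K)=((AH\vee\overline{H})\wedge(BK\vee\overline{K}))|(H\vee K)$. Iterated conditional: $(B|K)|_S(A|H)$ is the random quantity $(A|H)\wedge_S(B|K)+\mu\,(\overline{A}|H)$, where $\mu=\mathbb{P}[(B|K)|_S(A|H)]$ is its assessed prevision (the amount paid to receive it), the right-hand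 side being computed numerically from $x=P(A|H)$, $z=P[(A|H)\wedge_S(B|K)]$ and $\mu$. Also $y=P(B|K)$. Coherence: an assessment of real values $m_j$ on a finite family of such objects $X_j$ (conditional events, as random quantities, and iterated conditionals) is coherent iff for every nonempty subfamily $J$ and all reals $s_j$, the random gain $\sum_{j\in J}s_j(X_j-m_j)$, restricted to the cases where at least one of the bets in $J$ is not called off, has minimum $\le 0$ and maximum $\ge 0$. A bet on a conditional event is called off when it is void; a bet on the iterated conditional is called off in the cases where one receives back the paid amount $\mu$ whatever $\mu$ is (taking into account the relation $z=x\mu$ required by linearity of coherent previsions). *)

theory Defs
  imports Complex_Main "HOL-Library.Indicator_Function"
begin

text \<open>
  An event is a set of elementary cases in the type \<open>'w\<close>. The impossible event is \<open>{}\<close>, and an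
  event is identified with its indicator.
\<close>

definition logically_independent :: "'w set \<Rightarrow> 'w set \<Rightarrow> 'w set \<Rightarrow> 'w set \<Rightarrow> bool" where
  "logically_independent A B H K \<longleftrightarrow>
     (\<forall>A' \<in> {A, - A}. \<forall>B' \<in> {B, - B}. \<forall>H' \<in> {H, - H}. \<forall>K' \<in> {K, - K}.
        A' \<inter> B' \<inter> H' \<inter> K' \<noteq> {})"

datatype 'w cond_event = Cond (event: "'w set") (given: "'w set")  (infix "|\<^sub>c" 55)

definition cond_neg :: "'w cond_event \<Rightarrow> 'w cond_event" where
  "cond_neg C = (- event C) |\<^sub>c given C"

definition void :: "'w cond_event \<Rightarrow> 'w set" where
  "void C = - given C"

definition cond_val :: "'w cond_event \<Rightarrow> real \<Rightarrow> 'w \<Rightarrow> real" where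
  "cond_val C p \<omega> = indicator (event C \<inter> given C) \<omega> + p * indicator (- given C) \<omega>"

lemma cond_val_neg: "cond_val (cond_neg C) (1 - p) \<omega> = 1 - cond_val C p \<omega>"
  by (auto simp: cond_val_def cond_neg_def indicator_def)

fun sob_conj :: "'w cond_event \<Rightarrow> 'w cond_event \<Rightarrow> 'w cond_event"  (infixr "\<and>\<^sub>S" 50) where
  "(A |\<^sub>c H) \<and>\<^sub>S (B |\<^sub>c K) = ((A \<inter> H \<union> - H) \<inter> (B \<inter> K \<union> - K)) |\<^sub>c (H \<union> K)"

text \<open>
  \<open>iter_val C D x z \<mu>\<close> is the iterated conditional with antecedent \<open>C\<close> and consequent \<open>D\<close>,
  where \<open>x = P(C)\<close>, \<open>z = P(C \<and>\<^sub>S D)\<close>, and \<open>\<mu>\<close> is its own prevision.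
\<close>

definition iter_val ::
    "'w cond_event \<Rightarrow> 'w cond_event \<Rightarrow> real \<Rightarrow> real \<Rightarrow> real \<Rightarrow> 'w \<Rightarrow> real" where
  "iter_val C D x z \<mu> \<omega> = cond_val (C \<and>\<^sub>S D) z \<omega> + \<mu> * cond_val (cond_neg C) (1 - x) \<omega>"

text \<open>
  The cases where the paid amount \<open>m\<close> is received back for every \<open>m\<close>, with the prevision of the
  conjunction tied to \<open>m\<close> by \<open>z = x * m\<close>. The set depends on \<open>x\<close>: see \<open>iter_called_off_eq\<close>.
\<close>

definition iter_called_off :: "'w cond_event \<Rightarrow> 'w cond_event \<Rightarrow> real \<Rightarrow> 'w set" where
  "iter_called_off C D x = {\<omega>. \<forall>m. iter_val C D x (x * m) m \<omega> = m}"

lemma iter_called_off_eq: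
  "iter_called_off (A |\<^sub>c H) (B |\<^sub>c K) x =
     (- A \<inter> H) \<union> (- H \<inter> - K) \<union> (if x = 0 then - H \<inter> - B \<inter> K else {})"
proof (rule set_eqI)
  fix \<omega>
  have 1: "\<exists>m::real. m \<noteq> 0" "\<exists>m::real. m \<noteq> 1"
    by (auto intro: exI[of _ 2])
  have 2: "\<exists>m::real. 1 + m * (1 - x) \<noteq> m"
    by (rule exI[of _ 0]) simp
  have 3: "(\<forall>m::real. m * (1 - x) = m) \<longleftrightarrow> x = 0"
    by (auto dest: spec[of _ 1])
  have 4: "x * m + m * (1 - x) = m" for m :: real
    by (simp add: algebra_simps)
  show "\<omega> \<in> iter_called_off (A |\<^sub>c H) (B |\<^sub>c K) x \<longleftrightarrow>
      \<omega> \<in> (- A \<inter> H) \<union> (- H \<inter> - K) \<union> (if x = 0 then - H \<inter> - B \<inter> K else {})"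
    using 1 2 3 4
    by (cases "\<omega> \<in> A"; cases "\<omega> \<in> H"; cases "\<omega> \<in> B"; cases "\<omega> \<in> K")
      (simp_all add: iter_called_off_def iter_val_def cond_val_def cond_neg_def
        del: mult_cancel_left1 mult_cancel_left2 mult_cancel_right1 mult_cancel_right2)
qed

text \<open>
  A bet receives the random quantity \<open>payoff\<close> for the amount \<open>price\<close>. The set \<open>off\<close> collects the
  cases where it is called off.
\<close>

datatype 'w bet = Bet (payoff: "'w \<Rightarrow> real") (off: "'w set") (price: real)

definition cond_bet :: "'w cond_event \<Rightarrow> real \<Rightarrow> 'w bet" where
  "cond_bet C p = Bet (cond_val C p) (void C) p"

definition iter_bet ::
    "'w cond_event \<Rightarrow> 'w cond_event \<Rightarrow> real \<Rightarrow> real \<Rightarrow> real \<Rightarrow> 'w bet" where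
  "iter_bet C D x z \<mu> = Bet (iter_val C D x z \<mu>) (iter_called_off C D x) \<mu>"

definition gain :: "'w bet list \<Rightarrow> nat set \<Rightarrow> (nat \<Rightarrow> real) \<Rightarrow> 'w \<Rightarrow> real" where
  "gain bs J s \<omega> = (\<Sum>j\<in>J. s j * (payoff (bs ! j) \<omega> - price (bs ! j)))"

definition active :: "'w bet list \<Rightarrow> nat set \<Rightarrow> 'w set" where
  "active bs J = {\<omega>. \<exists>j\<in>J. \<omega> \<notin> off (bs ! j)}"

text \<open>
  \<open>Min\<close> and \<open>Max\<close> are meaningful on finite nonempty sets. The gains of conditional and iterated bets
  have finite range even when the space of cases is infinite, see \<open>finite_gain\<close> below.
\<close>

definition coherent :: "'w bet list \<Rightarrow> bool" where
  "coherent bs \<longleftrightarrow>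
     (\<forall>J s. J \<subseteq> {..<length bs} \<and> J \<noteq> {} \<longrightarrow>
        Min (gain bs J s ` active bs J) \<le> 0 \<and> 0 \<le> Max (gain bs J s ` active bs J))"

lemma finite_range_cond_val: "finite (range (cond_val C p))"
  by (rule finite_subset[of _ "{0, 1, p}"]) (auto simp: cond_val_def indicator_def)

lemma finite_range_iter_val: "finite (range (iter_val C D x z \<mu>))"
  by (rule finite_subset[of _ "(\<lambda>(a, b). a + \<mu> * b) `
        (range (cond_val (C \<and>\<^sub>S D) z) \<times> range (cond_val (cond_neg C) (1 - x)))"])
    (auto simp: iter_val_def finite_range_cond_val)

lemma finite_gain:
  assumes "J \<subseteq> {..<length bs}" and "\<And>b. b \<in> set bs \<Longrightarrow> finite (range (payoff b))"
  shows "finite (gain bs J s ` S)"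
proof -
  have "finite J" using assms(1) finite_subset by blast
  then have "finite (range (gain bs J s))" using assms(1)
  proof (induction J rule: finite_induct)
    case empty
    show ?case by (simp add: gain_def image_def)
  next
    case (insert i J)
    have fi: "finite (range (payoff (bs ! i)))" using insert.prems assms(2) by auto
    have "range (gain bs (insert i J) s) \<subseteq>
        (\<lambda>(a, g). s i * (a - price (bs ! i)) + g) ` (range (payoff (bs ! i)) \<times> range (gain bs J s))"
      using insert.hyps by (force simp: gain_def)
    then show ?case
      by (rule finite_subset) (use fi insert in auto)
  qed
  then show ?thesis by (rule finite_subset[rotated]) auto
qed

definition assessment_bets ::
    "'w set \<Rightarrow> 'w set \<Rightarrow> 'w set \<Rightarrow> 'w set \<Rightarrow> real \<times> real \<times> real \<times> real \<Rightarrow> 'w bet list" where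
  "assessment_bets A B H K = (\<lambda>(x, y, z, \<mu>).
     [cond_bet (A |\<^sub>c H) x,
      cond_bet (B |\<^sub>c K) y,
      cond_bet ((A |\<^sub>c H) \<and>\<^sub>S (B |\<^sub>c K)) z,
      iter_bet (A |\<^sub>c H) (B |\<^sub>c K) x z \<mu>])"

definition z_lower :: "real \<Rightarrow> real \<Rightarrow> real" where
  "z_lower x y = max (x + y - 1) 0"

definition z_upper :: "real \<Rightarrow> real \<Rightarrow> real" where
  "z_upper x y = (if (x, y) \<noteq> (1, 1) then (x + y - 2 * x * y) / (1 - x * y) else 1)"

end

theory Submission
  imports Defs
begin

text \<open>
  Coherence is a theorem of the alternative: a bad assessment is refuted by one combination of bets
  that wins in every active case, and a good one is certified by nonnegative weights on the cases
  under which each single bet is fair, since then no combination can win in all the cases that carry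
  weight (\<open>nonpos_gain_if_balanced\<close>).

  The iterated conditional brings in only one new constraint. By \<open>excess_iter_bet\<close> its net gain is,
  in every case, that of the conjunction minus \<open>\<mu>\<close> times that of \<open>A|H\<close>, plus the constant \<open>z - x\<mu>\<close>.
  Combining the three bets therefore yields a sure gain of either sign unless \<open>z = x\<mu>\<close>; and once
  \<open>z = x\<mu>\<close>, weights that make the first three bets fair make the fourth one fair as well.

  What remains is the range of \<open>z\<close> for given \<open>x\<close> and \<open>y\<close>. Pairs of truth values of \<open>A|H\<close> and \<open>B|K\<close>
  are written with the letters \<open>t\<close>, \<open>f\<close>, \<open>v\<close> (true, false, void). The lower bound is the Frechet
  bound, attained by weights under which neither conditional event is ever void. Except for
  \<open>x = y = 1\<close>, the upper bound is attained by weights on \<open>tv\<close>, \<open>vt\<close> and \<open>ff\<close>, where one conditional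
  event is true only while the other is void; the matching refutation has equal gains on these three
  pairs. Mixtures of the two extreme weights reach all values in between (\<open>balancing_ex\<close>).

  The same weights serve every subfamily of bets that is not called off on all of their support. The
  only subfamilies for which this can fail are \<open>A|H\<close> alone, \<open>B|K\<close> alone, and, for \<open>x = 0\<close>, the
  iterated conditional alone. The last one gives the condition \<open>\<mu> \<ge> 0\<close> of the second part of the set: when \<open>x = 0\<close> the bet is called off
  on \<open>vf\<close>, so its net gains are \<open>1 - \<mu>\<close>, \<open>- \<mu>\<close> and \<open>1\<close>, and they are all positive for \<open>\<mu> < 0\<close>.
\<close>

section \<open>Sure gains and balancing weights\<close>

definition excess :: "'w bet \<Rightarrow> 'w \<Rightarrow> real" where
  "excess b \<omega> = payoff b \<omega> - price b"

lemma activeI: "j \<in> J \<Longrightarrow> \<omega> \<notin> off (bs ! j) \<Longrightarrow> \<omega> \<in> active bs J"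
  by (auto simp: active_def)

lemma gain_eq_excess: "gain bs J s \<omega> = (\<Sum>j\<in>J. s j * excess (bs ! j) \<omega>)"
  by (simp add: gain_def excess_def)

text \<open>
  The condition on the maximum is the condition on the minimum for the opposite stakes, so one of the
  two suffices.
\<close>

lemma coherentI_nonpos_gain:
  assumes fin: "\<And>b. b \<in> set bs \<Longrightarrow> finite (range (payoff b))"
    and nonpos: "\<And>J s. J \<subseteq> {..<length bs} \<Longrightarrow> J \<noteq> {} \<Longrightarrow> \<exists>\<omega>\<in>active bs J. gain bs J s \<omega> \<le> 0"
  shows "coherent bs"
  unfolding coherent_def
proof (intro allI impI)
  fix J s assume J: "J \<subseteq> {..<length bs} \<and> J \<noteq> {}"
  have f: "finite (gain bs J s ` active bs J)" using finite_gain J fin by blast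
  obtain \<omega> where \<omega>: "\<omega> \<in> active bs J" "gain bs J s \<omega> \<le> 0" using nonpos J by blast
  obtain \<eta> where \<eta>: "\<eta> \<in> active bs J" "gain bs J (\<lambda>j. - s j) \<eta> \<le> 0" using nonpos J by blast
  have "gain bs J (\<lambda>j. - s j) \<eta> = - gain bs J s \<eta>"
    by (simp add: gain_def sum_negf)
  then have "0 \<le> gain bs J s \<eta>" using \<eta> by simp
  then show "Min (gain bs J s ` active bs J) \<le> 0 \<and> 0 \<le> Max (gain bs J s ` active bs J)"
    using \<omega> \<eta>(1) f by (meson Max_ge Min_le imageI order_trans)
qed

lemma coherent_nonpos_gain:
  assumes "coherent bs" and fin: "\<And>b. b \<in> set bs \<Longrightarrow> finite (range (payoff b))"
    and J: "J \<subseteq> {..<length bs}" and act: "active bs J \<noteq> {}"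
  shows "\<exists>\<omega>\<in>active bs J. gain bs J s \<omega> \<le> 0"
proof -
  have "J \<noteq> {}" using act by (auto simp: active_def)
  then have "Min (gain bs J s ` active bs J) \<le> 0" using assms(1) J by (auto simp: coherent_def)
  moreover have "Min (gain bs J s ` active bs J) \<in> gain bs J s ` active bs J"
    using act finite_gain[OF J fin] by (intro Min_in) auto
  ultimately show ?thesis by auto
qed

lemma weighted_gain:
  "(\<Sum>(w, \<omega>)\<leftarrow>ps. w * gain bs J s \<omega>) = (\<Sum>j\<in>J. s j * (\<Sum>(w, \<omega>)\<leftarrow>ps. w * excess (bs ! j) \<omega>))"
  by (induction ps)
    (auto simp: gain_eq_excess sum.distrib algebra_simps sum_distrib_left)

text \<open>
  The weights make every bet in \<open>J\<close> fair, so the weighted sum of any gain vanishes. Cases where all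
  bets in \<open>J\<close> are called off contribute nothing to it and may carry weight; this is what allows one
  list of weights to serve many subfamilies at once.
\<close>

lemma nonpos_gain_if_balanced:
  assumes nonneg: "\<And>w \<omega>. (w, \<omega>) \<in> set ps \<Longrightarrow> 0 \<le> w"
    and fair: "\<And>j. j \<in> J \<Longrightarrow> (\<Sum>(w, \<omega>)\<leftarrow>ps. w * excess (bs ! j) \<omega>) = 0"
    and off: "\<And>j w \<omega>. j \<in> J \<Longrightarrow> (w, \<omega>) \<in> set ps \<Longrightarrow> \<omega> \<in> off (bs ! j) \<Longrightarrow> excess (bs ! j) \<omega> = 0"
    and pos: "(v, \<eta>) \<in> set ps" "0 < v" "\<eta> \<in> active bs J"
  shows "\<exists>\<omega>\<in>active bs J. gain bs J s \<omega> \<le> 0"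
proof (rule ccontr)
  assume "\<not> ?thesis"
  then have gt: "0 < gain bs J s \<omega>" if "\<omega> \<in> active bs J" for \<omega> using that by force
  have ge: "0 \<le> w * gain bs J s \<omega>" if "(w, \<omega>) \<in> set ps" for w \<omega>
  proof (cases "\<omega> \<in> active bs J")
    case True
    then show ?thesis using gt nonneg that by (simp add: less_imp_le)
  next
    case False
    then have "gain bs J s \<omega> = 0"
      using off that by (auto simp: gain_eq_excess active_def intro!: sum.neutral)
    then show ?thesis by simp
  qed
  have "v * gain bs J s \<eta> \<le> (\<Sum>(w, \<omega>)\<leftarrow>ps. w * gain bs J s \<omega>)"
  proof (rule member_le_sum_list)
    show "v * gain bs J s \<eta> \<in> set (map (\<lambda>(w, \<omega>). w * gain bs J s \<omega>) ps)"
      using pos(1) by force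
    show "0 \<le> g" if "g \<in> set (map (\<lambda>(w, \<omega>). w * gain bs J s \<omega>) ps)" for g
      using that ge by auto
  qed
  also have "\<dots> = 0" using fair by (simp add: weighted_gain)
  finally show False using mult_pos_pos[OF pos(2) gt[OF pos(3)]] by simp
qed

section \<open>The four bets\<close>

lemma logically_independent_ex:
  assumes "logically_independent A B H K"
  shows "\<exists>\<omega>. (\<omega> \<in> A \<longleftrightarrow> a) \<and> (\<omega> \<in> B \<longleftrightarrow> b) \<and> (\<omega> \<in> H \<longleftrightarrow> h) \<and> (\<omega> \<in> K \<longleftrightarrow> k)"
proof -
  have "(if a then A else - A) \<inter> (if b then B else - B) \<inter> (if h then H else - H) \<inter>
      (if k then K else - K) \<noteq> {}"
    using assms unfolding logically_independent_def by simp
  then obtain \<omega> where "\<omega> \<in> (if a then A else - A) \<inter> (if b then B else - B) \<inter>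
      (if h then H else - H) \<inter> (if k then K else - K)" by blast
  then have "(\<omega> \<in> A \<longleftrightarrow> a) \<and> (\<omega> \<in> B \<longleftrightarrow> b) \<and> (\<omega> \<in> H \<longleftrightarrow> h) \<and> (\<omega> \<in> K \<longleftrightarrow> k)"
    by (simp split: if_splits)
  then show ?thesis ..
qed

lemma excess_cond_bet:
  "excess (cond_bet C p) \<omega> =
     (if \<omega> \<in> given C then if \<omega> \<in> event C then 1 - p else - p else 0)"
  by (simp add: excess_def cond_bet_def cond_val_def)

text \<open>
  The terms \<open>\<mu> * (1 - A|H) - \<mu>\<close> collapse to \<open>- \<mu> * (A|H)\<close>, so the bet is a portfolio of the other two
  up to a constant, in every case including the void ones.
\<close>

lemma excess_iter_bet:
  "excess (iter_bet C D x z \<mu>) \<omega> =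
     excess (cond_bet (C \<and>\<^sub>S D) z) \<omega> - \<mu> * excess (cond_bet C x) \<omega> + (z - x * \<mu>)"
  by (simp add: excess_def cond_bet_def iter_bet_def iter_val_def cond_val_neg algebra_simps)

lemma off_cond_bet: "off (cond_bet C p) = - given C"
  by (simp add: cond_bet_def void_def)

lemma off_iter_bet:
  "off (iter_bet (A |\<^sub>c H) (B |\<^sub>c K) x z \<mu>) =
     (- A \<inter> H) \<union> (- H \<inter> - K) \<union> (if x = 0 then - H \<inter> - B \<inter> K else {})"
  by (simp add: iter_bet_def iter_called_off_eq)

lemma length_assessment_bets [simp]: "length (assessment_bets A B H K M) = 4"
  by (simp add: assessment_bets_def split: prod.splits)

lemma assessment_bets_nth:
  "assessment_bets A B H K (x, y, z, \<mu>) ! 0 = cond_bet (A |\<^sub>c H) x"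
  "assessment_bets A B H K (x, y, z, \<mu>) ! Suc 0 = cond_bet (B |\<^sub>c K) y"
  "assessment_bets A B H K (x, y, z, \<mu>) ! 2 = cond_bet ((A |\<^sub>c H) \<and>\<^sub>S (B |\<^sub>c K)) z"
  "assessment_bets A B H K (x, y, z, \<mu>) ! 3 = iter_bet (A |\<^sub>c H) (B |\<^sub>c K) x z \<mu>"
  by (simp_all add: assessment_bets_def)

lemma finite_range_assessment_bets:
  "b \<in> set (assessment_bets A B H K M) \<Longrightarrow> finite (range (payoff b))"
  by (auto simp: assessment_bets_def cond_bet_def iter_bet_def
      finite_range_cond_val finite_range_iter_val split: prod.splits)

lemma active_assessment_bets_nonempty:
  assumes ind: "logically_independent A B H K" and J: "J \<subseteq> {..<4}" "J \<noteq> {}"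
  shows "active (assessment_bets A B H K M) J \<noteq> {}"
proof -
  obtain x y z \<mu> where M: "M = (x, y, z, \<mu>)" by (metis prod.exhaust)
  obtain \<omega> where \<omega>: "\<omega> \<in> A" "\<omega> \<in> B" "\<omega> \<in> H" "\<omega> \<in> K"
    using logically_independent_ex[OF ind, of True True True True] by auto
  obtain j where j: "j \<in> J" using J(2) by auto
  then have "j \<in> {0, 1, 2, 3}" using J(1) by auto
  then have "\<omega> \<notin> off (assessment_bets A B H K M ! j)"
    using \<omega> by (auto simp: M assessment_bets_nth off_cond_bet off_iter_bet split: if_splits)
  with j have "\<omega> \<in> active (assessment_bets A B H K M) J" by (rule activeI)
  then show ?thesis by blast
qed

section \<open>Refuting combinations of bets\<close>

lemma mult_less_one_if_not_both_one:
  fixes x y :: real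
  assumes "x \<in> {0..1}" "y \<in> {0..1}" "(x, y) \<noteq> (1, 1)"
  shows "x * y < 1"
proof -
  have "x * y \<le> x" "x * y \<le> y"
    using assms by (simp_all add: mult_left_le mult_left_le_one_le)
  then show ?thesis using assms by auto
qed

lemma coherent_ex_nonpos_gain:
  assumes "logically_independent A B H K" "coherent (assessment_bets A B H K M)"
    and "J \<subseteq> {..<4}" "J \<noteq> {}"
  shows "\<exists>\<omega>\<in>active (assessment_bets A B H K M) J. gain (assessment_bets A B H K M) J s \<omega> \<le> 0"
  by (rule coherent_nonpos_gain[OF assms(2) finite_range_assessment_bets])
    (use assms active_assessment_bets_nonempty[OF assms(1,3,4), of M] in simp_all)

lemma sure_gain_contradiction:
  assumes "logically_independent A B H K" "coherent (assessment_bets A B H K M)"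
    and "J \<subseteq> {..<4}" "J \<noteq> {}"
    and "\<And>\<omega>. \<omega> \<in> active (assessment_bets A B H K M) J \<Longrightarrow>
      0 < (\<Sum>j\<in>J. s j * excess (assessment_bets A B H K M ! j) \<omega>)"
  shows False
  using coherent_ex_nonpos_gain[OF assms(1-4), of s] assms(5)
  by (force simp: gain_eq_excess)

lemma coherent_necessary:
  assumes ind: "logically_independent A B H K"
    and coh: "coherent (assessment_bets A B H K (x, y, z, \<mu>))" (is "coherent ?bs")
  shows "x \<in> {0..1}" "y \<in> {0..1}" "z \<in> {z_lower x y..z_upper x y}" "z = x * \<mu>"
    "x = 0 \<Longrightarrow> 0 \<le> \<mu>"
proof -
  note sure = sure_gain_contradiction[OF ind coh]
  note bets = assessment_bets_nth excess_cond_bet off_cond_bet active_def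
  have x0: "0 \<le> x"
    by (rule ccontr, rule sure[of "{0}" "\<lambda>_. 1"]) (auto simp: bets)
  have x1: "x \<le> 1"
    by (rule ccontr, rule sure[of "{0}" "\<lambda>_. - 1"]) (auto simp: bets)
  have y0: "0 \<le> y"
    by (rule ccontr, rule sure[of "{1}" "\<lambda>_. 1"]) (auto simp: bets)
  have y1: "y \<le> 1"
    by (rule ccontr, rule sure[of "{1}" "\<lambda>_. - 1"]) (auto simp: bets)
  have z0: "0 \<le> z"
    by (rule ccontr, rule sure[of "{2}" "\<lambda>_. 1"]) (auto simp: bets)
  have z1: "z \<le> 1"
    by (rule ccontr, rule sure[of "{2}" "\<lambda>_. - 1"]) (auto simp: bets)
  show "x \<in> {0..1}" "y \<in> {0..1}" using x0 x1 y0 y1 by auto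

  \<comment> \<open>Buying the iterated conditional and \<open>\<mu>\<close> units of \<open>A|H\<close> while selling the conjunction gives the
    constant net gain \<open>z - x\<mu>\<close>; the factor \<open>c\<close> allows the opposite trade.\<close>
  have eq: "\<not> 0 < c * (z - x * \<mu>)" for c
    by (rule notI, rule sure[of "{0, 2, 3}" "\<lambda>j. c * (if j = 0 then \<mu> else if j = 2 then - 1 else 1)"])
      (simp_all add: assessment_bets_nth excess_iter_bet algebra_simps)
  show "z = x * \<mu>" using eq[of 1] eq[of "- 1"] by simp
  show "0 \<le> \<mu>" if "x = 0"
    by (rule ccontr, rule sure[of "{3}" "\<lambda>_. 1"])
      (use that \<open>z = x * \<mu>\<close> in \<open>auto simp: bets excess_iter_bet off_iter_bet split: if_splits\<close>)

  \<comment> \<open>Buying the conjunction and selling both events: the smallest net gain is \<open>x + y - 1 - z\<close>, on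
    \<open>tt\<close>, \<open>tf\<close> and \<open>ft\<close>.\<close>
  have "x + y - 1 \<le> z"
  proof (rule ccontr)
    assume "\<not> ?thesis"
    then show False
      using x0 x1 y0 y1
      by (intro sure[of "{0, 1, 2}" "\<lambda>j. if j = 2 then 1 else - 1"]) (auto simp: bets)
  qed
  moreover have "z \<le> z_upper x y"
  proof (cases "(x, y) = (1, 1)")
    case False
    define d where "d = 1 - x * y"
    have "x * y < 1"
      using False x0 x1 y0 y1 by (intro mult_less_one_if_not_both_one) auto
    then have d: "0 < d" by (simp add: d_def)
    have "d * z \<le> x + y - 2 * x * y"
    proof (rule ccontr)
      assume "\<not> ?thesis"
      then have e: "0 < z - x * y * z - (x + y - 2 * x * y)" by (simp add: d_def algebra_simps)
      have p: "0 \<le> (1 - x) * (1 - y)" "0 \<le> (1 - x) * y" "0 \<le> x * (1 - y)"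
        using x0 x1 y0 y1 by simp_all
      \<comment> \<open>These stakes equalise the net gain on \<open>tv\<close>, \<open>vt\<close> and \<open>ff\<close> at \<open>d * z - (x + y - 2 * x * y)\<close>; on
        the other active pairs it is at least as large.\<close>
      show False
      proof (rule sure[of "{0, 1, 2}" "\<lambda>j. if j = 0 then 1 - y else if j = 1 then 1 - x else - d"])
        fix \<omega> assume "\<omega> \<in> active ?bs {0, 1, 2}"
        then show "0 < (\<Sum>j\<in>{0, 1, 2}. (if j = 0 then 1 - y else if j = 1 then 1 - x else - d) *
            excess (?bs ! j) \<omega>)"
          using e p x1 y1
          by (cases "\<omega> \<in> A"; cases "\<omega> \<in> B"; cases "\<omega> \<in> H"; cases "\<omega> \<in> K")
            (simp_all add: bets d_def algebra_simps)
      qed auto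
    qed
    then show ?thesis using False d
      by (simp add: z_upper_def d_def[symmetric] pos_le_divide_eq mult.commute del: prod.inject)
  qed (use z1 in \<open>simp add: z_upper_def\<close>)
  ultimately show "z \<in> {z_lower x y..z_upper x y}" using z0 by (simp add: z_lower_def)
qed

section \<open>Certifying weights\<close>

text \<open>
  Each entry is the probability of one pair of truth values of \<open>A|H\<close> (first letter) and \<open>B|K\<close>
  (second letter). The equations for \<open>x\<close> and \<open>y\<close> are multiplied out, so that they still make sense when
  the conditioning event has probability 0. The pairs \<open>fv\<close> and \<open>vf\<close> are left out: both extreme
  weightings do without them.
\<close>

definition balancing :: "real \<Rightarrow> real \<Rightarrow> real \<Rightarrow> real \<times> real \<times> real \<times> real \<times> real \<times> real \<Rightarrow> bool" where
  "balancing x y z = (\<lambda>(tt, tf, ft, ff, tv, vt).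
     0 \<le> tt \<and> 0 \<le> tf \<and> 0 \<le> ft \<and> 0 \<le> ff \<and> 0 \<le> tv \<and> 0 \<le> vt \<and>
     tt + tf + ft + ff + tv + vt = 1 \<and>
     tt + tf + tv = x * (tt + tf + tv + ft + ff) \<and>
     tt + ft + vt = y * (tt + ft + vt + tf + ff) \<and>
     tt + tv + vt = z)"

text \<open>
  All conditions are linear in the weights and \<open>z\<close> jointly, for fixed \<open>x\<close> and \<open>y\<close>.
\<close>

lemma balancing_mixture:
  assumes "balancing x y z1 W1" "balancing x y z2 W2" and "z \<in> {z1..z2}"
  shows "\<exists>W. balancing x y z W"
proof (cases "z1 = z2")
  case True
  then have "z = z1" using assms(3) by simp
  then show ?thesis using assms(1) by blast
next
  case False
  obtain a b c d e f where W1: "W1 = (a, b, c, d, e, f)" by (metis prod.exhaust)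
  obtain a' b' c' d' e' f' where W2: "W2 = (a', b', c', d', e', f')" by (metis prod.exhaust)
  define t where "t = (z - z1) / (z2 - z1)"
  have t: "0 \<le> t" "t \<le> 1" using assms(3) False by (auto simp: t_def)
  have zt: "z = (1 - t) * z1 + t * z2"
  proof -
    have "t * (z2 - z1) = z - z1" using False by (simp add: t_def)
    then show ?thesis by (simp add: algebra_simps)
  qed
  have u: "0 \<le> 1 - t" using t by simp
  have "balancing x y z ((1 - t) * a + t * a', (1 - t) * b + t * b', (1 - t) * c + t * c',
      (1 - t) * d + t * d', (1 - t) * e + t * e', (1 - t) * f + t * f')"
    unfolding balancing_def split_conv
  proof (intro conjI)
    note B1 = assms(1)[unfolded W1 balancing_def split_conv]
    note B2 = assms(2)[unfolded W2 balancing_def split_conv]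
    have s: "a + b + c + d + e + f = 1" "a' + b' + c' + d' + e' + f' = 1"
      "a + b + e = x * (a + b + e + c + d)" "a' + b' + e' = x * (a' + b' + e' + c' + d')"
      "a + c + f = y * (a + c + f + b + d)" "a' + c' + f' = y * (a' + c' + f' + b' + d')"
      "a + e + f = z1" "a' + e' + f' = z2"
      using B1 B2 by blast+
    show "0 \<le> (1 - t) * a + t * a'" "0 \<le> (1 - t) * b + t * b'" "0 \<le> (1 - t) * c + t * c'"
      "0 \<le> (1 - t) * d + t * d'" "0 \<le> (1 - t) * e + t * e'" "0 \<le> (1 - t) * f + t * f'"
      using B1 B2 t u by simp_all
    show "((1 - t) * a + t * a') + ((1 - t) * b + t * b') + ((1 - t) * c + t * c') +
      ((1 - t) * d + t * d') + ((1 - t) * e + t * e') + ((1 - t) * f + t * f') = 1"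
      using s(1,2) by algebra
    show "((1 - t) * a + t * a') + ((1 - t) * b + t * b') + ((1 - t) * e + t * e') =
      x * (((1 - t) * a + t * a') + ((1 - t) * b + t * b') + ((1 - t) * e + t * e') +
        ((1 - t) * c + t * c') + ((1 - t) * d + t * d'))"
      using s(3,4) by algebra
    show "((1 - t) * a + t * a') + ((1 - t) * c + t * c') + ((1 - t) * f + t * f') =
      y * (((1 - t) * a + t * a') + ((1 - t) * c + t * c') + ((1 - t) * f + t * f') +
        ((1 - t) * b + t * b') + ((1 - t) * d + t * d'))"
      using s(5,6) by algebra
    show "((1 - t) * a + t * a') + ((1 - t) * e + t * e') + ((1 - t) * f + t * f') = z"
      unfolding zt s(7,8)[symmetric] by (simp add: algebra_simps)
  qed
  then show ?thesis by blast
qed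

lemma balancing_lower:
  assumes "x \<in> {0..1}" "y \<in> {0..1}"
  defines "l \<equiv> z_lower x y"
  shows "balancing x y l (l, x - l, y - l, 1 - x - y + l, 0, 0)"
  using assms(1,2) by (auto simp: balancing_def l_def z_lower_def max_def)

text \<open>
  On \<open>tv\<close>, \<open>vt\<close>, \<open>ff\<close> the odds of \<open>A|H\<close> and of \<open>B|K\<close> are \<open>tv / ff\<close> and \<open>vt / ff\<close>. Prescribing them as
  \<open>x / (1 - x)\<close> and \<open>y / (1 - y)\<close> fixes the weights up to scale, and \<open>1 - x * y\<close> is their total after
  clearing denominators. It vanishes only for \<open>x = y = 1\<close>, where \<open>tt\<close> alone will do.
\<close>

lemma balancing_upper:
  assumes "x \<in> {0..1}" "y \<in> {0..1}"
  shows "\<exists>W. balancing x y (z_upper x y) W"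
proof (cases "(x, y) = (1, 1)")
  case True
  then have "balancing x y (z_upper x y) (1, 0, 0, 0, 0, 0)"
    by (simp add: balancing_def z_upper_def)
  then show ?thesis ..
next
  case False
  define d where "d = 1 - x * y"
  have "x * y < 1"
    using False assms by (intro mult_less_one_if_not_both_one) auto
  then have d: "0 < d" by (simp add: d_def)
  have "balancing x y (z_upper x y)
      (0, 0, 0, (1 - x) * (1 - y) / d, x * (1 - y) / d, y * (1 - x) / d)"
    using assms d False unfolding balancing_def z_upper_def split_conv
    by (auto simp: add_divide_distrib[symmetric] d_def[symmetric] divide_eq_eq)
      (simp_all add: d_def algebra_simps)
  then show ?thesis ..
qed

lemma balancing_ex:
  assumes "x \<in> {0..1}" "y \<in> {0..1}" "z \<in> {z_lower x y..z_upper x y}"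
  shows "\<exists>W. balancing x y z W"
  using balancing_lower[OF assms(1,2)] balancing_upper[OF assms(1,2)] assms(3)
    balancing_mixture by blast

text \<open>
  This needs \<open>z = x\<mu>\<close>: the set of cases where the iterated conditional is called off is determined with
  the prevision of the conjunction tied to \<open>\<mu>\<close> in this way.
\<close>

lemma excess_eq_0_if_off:
  assumes "z = x * \<mu>" "j < 4" "\<omega> \<in> off (assessment_bets A B H K (x, y, z, \<mu>) ! j)"
  shows "excess (assessment_bets A B H K (x, y, z, \<mu>) ! j) \<omega> = 0"
proof -
  have "j \<in> {0, 1, 2, 3}" using assms(2) by auto
  then show ?thesis
    using assms(1,3)
    by (elim insertE)
      (auto simp: assessment_bets_nth excess_iter_bet excess_cond_bet
        off_cond_bet off_iter_bet algebra_simps split: if_splits)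
qed

text \<open>
  The three exceptional subfamilies are settled by two cases in which the single bet has net gains of
  opposite signs, or a zero one. The weights do not always cover them: for \<open>0 < x < 1 = y\<close> and
  \<open>z = z_upper x y = 1\<close> all weight lies on \<open>vt\<close>, where \<open>A|H\<close> is void, and symmetrically for
  \<open>B|K\<close>; for \<open>x = 0\<close> it lies on \<open>ft\<close> and \<open>ff\<close>, where the iterated conditional is called off.
\<close>

lemma coherent_sufficient:
  assumes ind: "logically_independent A B H K"
    and xy: "x \<in> {0..1}" "y \<in> {0..1}" and z: "z \<in> {z_lower x y..z_upper x y}"
    and z\<mu>: "z = x * \<mu>" and \<mu>: "x = 0 \<Longrightarrow> 0 \<le> \<mu>"
  shows "coherent (assessment_bets A B H K (x, y, z, \<mu>))" (is "coherent ?bs")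
proof (rule coherentI_nonpos_gain)
  show "finite (range (payoff b))" if "b \<in> set ?bs" for b
    using that by (rule finite_range_assessment_bets)
  fix J :: "nat set" and s
  assume "J \<subseteq> {..<length ?bs}" "J \<noteq> {}"
  then have J: "J \<subseteq> {0, 1, 2, 3}" "J \<noteq> {}" by auto
  have off: "excess (?bs ! j) \<omega> = 0" if "j \<in> J" "\<omega> \<in> off (?bs ! j)" for j \<omega>
    using that J(1) by (intro excess_eq_0_if_off[OF z\<mu>]) auto
  have ex: "\<exists>\<omega>. (\<omega> \<in> A \<longleftrightarrow> a) \<and> (\<omega> \<in> B \<longleftrightarrow> b) \<and> (\<omega> \<in> H \<longleftrightarrow> h) \<and> (\<omega> \<in> K \<longleftrightarrow> k)" for a b h k
    by (rule logically_independent_ex[OF ind])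
  obtain TT where TT: "TT \<in> A" "TT \<in> B" "TT \<in> H" "TT \<in> K" using ex[of True True True True] by auto
  obtain TF where TF: "TF \<in> A" "TF \<notin> B" "TF \<in> H" "TF \<in> K" using ex[of True False True True] by auto
  obtain FT where FT: "FT \<notin> A" "FT \<in> B" "FT \<in> H" "FT \<in> K" using ex[of False True True True] by auto
  obtain FF where FF: "FF \<notin> A" "FF \<notin> B" "FF \<in> H" "FF \<in> K" using ex[of False False True True] by auto
  obtain TV where TV: "TV \<in> A" "TV \<in> H" "TV \<notin> K" using ex[of True True True False] by auto
  obtain VT where VT: "VT \<in> B" "VT \<notin> H" "VT \<in> K" using ex[of True True False True] by auto
  note cells = TT TF FT FF TV VT
  note bets = assessment_bets_nth excess_cond_bet excess_iter_bet
  note offs = assessment_bets_nth off_cond_bet off_iter_bet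
  consider (antecedent) "J = {0}" | (consequent) "J = {1}" | (iterated) "J = {3}" "x = 0"
    | (joint) "J \<noteq> {0}" "J \<noteq> {1}" "x = 0 \<Longrightarrow> J \<noteq> {3}" by blast
  then show "\<exists>\<omega>\<in>active ?bs J. gain ?bs J s \<omega> \<le> 0"
  proof cases
    case antecedent
    have "TT \<in> active ?bs J" "FT \<in> active ?bs J"
      using cells by (simp_all add: antecedent active_def offs)
    moreover have "gain ?bs J s TT \<le> 0 \<or> gain ?bs J s FT \<le> 0"
      using cells xy by (auto simp: antecedent gain_eq_excess bets mult_le_0_iff zero_le_mult_iff)
    ultimately show ?thesis by blast
  next
    case consequent
    have "TT \<in> active ?bs J" "TF \<in> active ?bs J"
      using cells by (simp_all add: consequent active_def offs)
    moreover have "gain ?bs J s TT \<le> 0 \<or> gain ?bs J s TF \<le> 0"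
      using cells xy by (auto simp: consequent gain_eq_excess bets mult_le_0_iff zero_le_mult_iff)
    ultimately show ?thesis by blast
  next
    case iterated
    have "VT \<in> active ?bs J" "TF \<in> active ?bs J"
      using cells by (simp_all add: iterated active_def offs)
    moreover have "gain ?bs J s VT \<le> 0 \<or> gain ?bs J s TF \<le> 0"
      using cells z\<mu> \<mu> iterated
      by (auto simp: gain_eq_excess bets mult_le_0_iff zero_le_mult_iff)
    ultimately show ?thesis by blast
  next
    case joint
    obtain tt tf ft ff tv vt where W: "balancing x y z (tt, tf, ft, ff, tv, vt)"
      using balancing_ex[OF xy z] by auto
    then have W_nonneg: "0 \<le> tt" "0 \<le> tf" "0 \<le> ft" "0 \<le> ff" "0 \<le> tv" "0 \<le> vt"
      and total: "tt + tf + ft + ff + tv + vt = 1"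
      and eqs: "tt + tf + tv = x * (tt + tf + tv + ft + ff)"
        "tt + ft + vt = y * (tt + ft + vt + tf + ff)" "tt + tv + vt = z"
      by (simp_all add: balancing_def)
    define ps where "ps = [(tt, TT), (tf, TF), (ft, FT), (ff, FF), (tv, TV), (vt, VT)]"
    have nonneg: "0 \<le> w" if "(w, \<omega>) \<in> set ps" for w \<omega>
      using that W_nonneg by (auto simp: ps_def)
    have fair_cond: "(\<Sum>(w, \<omega>)\<leftarrow>ps. w * excess (?bs ! 0) \<omega>) = 0"
        "(\<Sum>(w, \<omega>)\<leftarrow>ps. w * excess (?bs ! 1) \<omega>) = 0"
      using eqs(1,2) cells by (simp_all add: ps_def bets algebra_simps)
    have "(\<Sum>(w, \<omega>)\<leftarrow>ps. w * excess (?bs ! 2) \<omega>) = tt + tv + vt - z * (tt + tf + ft + ff + tv + vt)"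
      using cells by (simp add: ps_def bets algebra_simps)
    then have fair_conj: "(\<Sum>(w, \<omega>)\<leftarrow>ps. w * excess (?bs ! 2) \<omega>) = 0"
      using total eqs(3) by simp
    have "(\<Sum>(w, \<omega>)\<leftarrow>ps. w * excess (?bs ! 3) \<omega>) =
        (\<Sum>(w, \<omega>)\<leftarrow>ps. w * excess (?bs ! 2) \<omega>) - \<mu> * (\<Sum>(w, \<omega>)\<leftarrow>ps. w * excess (?bs ! 0) \<omega>)"
      using z\<mu> by (simp add: ps_def assessment_bets_nth excess_iter_bet algebra_simps)
    then have fair: "(\<Sum>(w, \<omega>)\<leftarrow>ps. w * excess (?bs ! j) \<omega>) = 0" if "j \<in> J" for j
      using that J(1) fair_cond fair_conj by auto
    have "\<exists>v \<eta>. (v, \<eta>) \<in> set ps \<and> 0 < v \<and> \<eta> \<in> active ?bs J"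
    proof (cases "2 \<in> J \<or> {0, 1} \<subseteq> J")
      case True
      \<comment> \<open>All six pairs lie in \<open>H \<union> K\<close>, so every case that carries weight is active.\<close>
      have "\<eta> \<in> active ?bs J" if "(v, \<eta>) \<in> set ps" for v \<eta>
      proof (cases "2 \<in> J")
        case True
        moreover have "\<eta> \<notin> off (?bs ! 2)" using that cells by (auto simp: ps_def offs)
        ultimately show ?thesis by (rule activeI)
      next
        case False
        then have "0 \<in> J" "1 \<in> J" using True by auto
        moreover have "\<eta> \<notin> off (?bs ! 0) \<or> \<eta> \<notin> off (?bs ! 1)"
          using that cells by (auto simp: ps_def offs)
        ultimately show ?thesis using activeI by metis
      qed
      moreover have "\<exists>v \<eta>. (v, \<eta>) \<in> set ps \<and> 0 < v"
      proof -
        have "0 < tt \<or> 0 < tf \<or> 0 < ft \<or> 0 < ff \<or> 0 < tv \<or> 0 < vt" using total by linarith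
        then show ?thesis by (auto simp: ps_def)
      qed
      ultimately show ?thesis by blast
    next
      case nJ: False
      have J3: "3 \<in> J" using nJ joint J by auto
      show ?thesis
      proof (cases "x = 0")
        case True
        then have "0 \<in> J \<or> 1 \<in> J" using nJ joint(3) J by auto
        moreover have "FT \<notin> off (?bs ! j)" "FF \<notin> off (?bs ! j)" if "j = 0 \<or> j = 1" for j
          using that cells by (elim disjE; simp add: offs)+
        ultimately have "FT \<in> active ?bs J" "FF \<in> active ?bs J" using activeI by metis+
        \<comment> \<open>With \<open>x = 0\<close> also \<open>z = 0\<close>, which empties all pairs that make the conjunction true.\<close>
        moreover have "0 < ft \<or> 0 < ff"
          using True W_nonneg total eqs z\<mu> by auto
        ultimately show ?thesis by (auto simp: ps_def)
      next
        case False
        have "TT \<in> active ?bs J" "TF \<in> active ?bs J" "TV \<in> active ?bs J" "VT \<in> active ?bs J"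
          using cells False by (auto simp: offs intro!: activeI[OF J3])
        \<comment> \<open>Otherwise all weight would be on \<open>ft\<close> and \<open>ff\<close>, forcing \<open>x = 0\<close>.\<close>
        moreover have "0 < tt \<or> 0 < tf \<or> 0 < tv \<or> 0 < vt"
        proof (rule ccontr)
          assume "\<not> ?thesis"
          then have 0: "tt = 0" "tf = 0" "tv = 0" "vt = 0" using W_nonneg by auto
          then have "ft + ff = 1" "x * (ft + ff) = 0" using total eqs(1) by simp_all
          then show False using False by simp
        qed
        ultimately show ?thesis by (auto simp: ps_def)
      qed
    qed
    then show ?thesis
      using nonpos_gain_if_balanced[of ps J ?bs] nonneg fair off by blast
  qed
qed

theorem theorem17:
  fixes A B H K :: "'w set"
  assumes "logically_independent A B H K"
  shows "{M. coherent (assessment_bets A B H K M)} =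
    {(x, y, z, \<mu>). x \<in> {0<..1} \<and> y \<in> {0..1} \<and> z \<in> {z_lower x y..z_upper x y} \<and> \<mu> = z / x}
    \<union> {(x, y, z, \<mu>). x = 0 \<and> y \<in> {0..1} \<and> z = 0 \<and> \<mu> \<ge> 0}"
proof (rule set_eqI)
  fix M :: "real \<times> real \<times> real \<times> real"
  obtain x y z \<mu> where M: "M = (x, y, z, \<mu>)" by (metis prod.exhaust)
  have "coherent (assessment_bets A B H K (x, y, z, \<mu>)) \<longleftrightarrow>
    x \<in> {0..1} \<and> y \<in> {0..1} \<and> z \<in> {z_lower x y..z_upper x y} \<and> z = x * \<mu> \<and> (x = 0 \<longrightarrow> 0 \<le> \<mu>)"
    using coherent_necessary[OF assms, of x y z \<mu>] coherent_sufficient[OF assms, of x y z \<mu>] by blast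
  also have "\<dots> \<longleftrightarrow> x \<in> {0<..1} \<and> y \<in> {0..1} \<and> z \<in> {z_lower x y..z_upper x y} \<and> \<mu> = z / x \<or>
      x = 0 \<and> y \<in> {0..1} \<and> z = 0 \<and> \<mu> \<ge> 0"
    by (cases "x = 0") (auto simp: z_lower_def z_upper_def)
  finally show "M \<in> {M. coherent (assessment_bets A B H K M)} \<longleftrightarrow>
    M \<in> {(x, y, z, \<mu>). x \<in> {0<..1} \<and> y \<in> {0..1} \<and> z \<in> {z_lower x y..z_upper x y} \<and> \<mu> = z / x}
    \<union> {(x, y, z, \<mu>). x = 0 \<and> y \<in> {0..1} \<and> z = 0 \<and> \<mu> \<ge> 0}"
    by (simp add: M)
qed

end
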